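(* Let $n\geq 4$ and $0\le p\le 1$. In the $n$-dimensional bubble-sort network $B_n$ under the random node fault model in which each node is fault-free independently with probability $p$, $$P(2,0,2)=\tfrac{1}{2}(8n^5+8n^4-174n^3+347n^2-189n)p^{4(n-2)!}+16(3n^5-25n^4+75n^3-95n^2+42n)p^{4(n-2)!-(n-4)!}+4(6n^6-73n^5+345n^4-785n^3+849n^2-342n)p^{4(n-2)!-2(n-4)!}+2(2n^7-33n^6+223n^5-785n^4+1503n^3-1462n^2+552n)p^{4(n-2)!-3(n-4)!}+\tfrac{1}{4}(n^8-20n^7+172n^6-822n^5+2340n^4-3916n^3+3499n^2-1254n)p^{4(n-2)!-4(n-4)!}.$$
   Context: Let $N_n=\{1,\dots,n\}$. The bubble-sort network $B_n$ has as vertices the permutations of $N_n$, written as strings $u_1u_2\cdots u_n$, two permutations being adjacent iff they differ by swapping two adjacent positions $u_i,u_{i+1}$. For distinct $a_1,a_2\in N_n$, a $B_{n-2}$-subnetwork of $B_n$ is one of the following vertex sets (each inducing a copy of $B_{n-2}$ and having $(n-2)!$ vertices): $a_1a_2X^{n-2}$, the set of permutations with $u_1=a_1,u_2=a_2$ ("prefix form"); $a_1X^{n-2}a_2$, the set with $u_1=a_1,u_n=a_2$ ("middle form"); $X^{n-2}a_1a_2$, the set with $u_{n-1}=a_1,u_n=a_2$ ("suffix form"). Each form gives $n(n-1)$ subnetworks. In the random node fault model each vertex is fault-free independently with probability $p$ (faulty with probability $1-p$); a subnetwork is fault-free if all its vertices are. For nonnegative integers $i,j,k$ with $i+j+k=4$,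 $P(i,j,k)$ denotes the sum, over all sets $S$ of four distinct $B_{n-2}$-subnetworks consisting of $i$ of prefix form, $j$ of middle form and $k$ of suffix form, of the probability that all four members of $S$ are fault-free, i.e. of $p^{|\bigcup_{H\in S}H|}$. (The paper calls $P(i,j,k)$ "the probability that there are four fault-free $B_{n-2}$'s, $i$ of which are of prefix form, $j$ of middle form and $k$ of suffix form".) *)

theory Defs
  imports "HOL-Probability.Probability" "HOL-Combinatorics.Multiset_Permutations"
    "Graph_Theory.Pair_Digraph"
begin

text \<open>
  A permutation u of {1..n} is the duplicate-free list of its n symbols; list positions are
  counted from 0, so the i-th symbol of the string is \<open>u ! (i - 1)\<close>. The undirected network is
  given by a symmetric arc relation.
\<close>

definition bubble_sort_network :: "nat \<Rightarrow> nat list pair_pre_digraph" where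
  "bubble_sort_network n =
     \<lparr> pverts = permutations_of_set {1..n},
       parcs = {(u, v). u \<in> permutations_of_set {1..n} \<and>
                 (\<exists>i. Suc i < n \<and> v = u[i := u ! Suc i, Suc i := u ! i])} \<rparr>"

definition prefix_subnetwork :: "nat \<Rightarrow> nat \<Rightarrow> nat \<Rightarrow> nat list set" where
  "prefix_subnetwork n a b = {u \<in> pverts (bubble_sort_network n). u ! 0 = a \<and> u ! 1 = b}"

definition middle_subnetwork :: "nat \<Rightarrow> nat \<Rightarrow> nat \<Rightarrow> nat list set" where
  "middle_subnetwork n a b = {u \<in> pverts (bubble_sort_network n). u ! 0 = a \<and> u ! (n - 1) = b}"

definition suffix_subnetwork :: "nat \<Rightarrow> nat \<Rightarrow> nat \<Rightarrow> nat list set" where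
  "suffix_subnetwork n a b =
     {u \<in> pverts (bubble_sort_network n). u ! (n - 2) = a \<and> u ! (n - 1) = b}"

definition prefix_forms :: "nat \<Rightarrow> nat list set set" where
  "prefix_forms n = {prefix_subnetwork n a b | a b. a \<in> {1..n} \<and> b \<in> {1..n} \<and> a \<noteq> b}"

definition middle_forms :: "nat \<Rightarrow> nat list set set" where
  "middle_forms n = {middle_subnetwork n a b | a b. a \<in> {1..n} \<and> b \<in> {1..n} \<and> a \<noteq> b}"

definition suffix_forms :: "nat \<Rightarrow> nat list set set" where
  "suffix_forms n = {suffix_subnetwork n a b | a b. a \<in> {1..n} \<and> b \<in> {1..n} \<and> a \<noteq> b}"

text \<open>
  An outcome maps each node to \<open>True\<close> iff it is fault-free; lists that are not nodes of the
  network get the irrelevant default value \<open>False\<close>.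
\<close>

definition node_fault_model :: "nat \<Rightarrow> real \<Rightarrow> (nat list \<Rightarrow> bool) pmf" where
  "node_fault_model n p =
     Pi_pmf (pverts (bubble_sort_network n)) False (\<lambda>_. bernoulli_pmf p)"

definition fault_free :: "(nat list \<Rightarrow> bool) \<Rightarrow> nat list set \<Rightarrow> bool" where
  "fault_free \<omega> H \<longleftrightarrow> (\<forall>u\<in>H. \<omega> u)"

text \<open>
  For \<open>n \<ge> 4\<close> the three families of forms are pairwise disjoint. The sum below adds up the
  probabilities of the (not mutually exclusive) events belonging to the individual sets S, so
  its value can exceed 1.
\<close>

definition P4 :: "nat \<Rightarrow> real \<Rightarrow> nat \<Rightarrow> nat \<Rightarrow> nat \<Rightarrow> real" where
  "P4 n p i j k =
     (\<Sum>S | S \<subseteq> prefix_forms n \<union> middle_forms n \<union> suffix_forms n \<and> card S = 4 \<and>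
           card (S \<inter> prefix_forms n) = i \<and> card (S \<inter> middle_forms n) = j \<and>
           card (S \<inter> suffix_forms n) = k.
        measure_pmf.prob (node_fault_model n p) {\<omega>. \<forall>H\<in>S. fault_free \<omega> H})"

end

theory Submission
  imports Defs
begin

text \<open>
  Subnetworks of the same form are disjoint, and a prefix form \<open>a b\<close> meets a suffix form \<open>c d\<close>
  exactly when \<open>{a, b}\<close> and \<open>{c, d}\<close> are disjoint, the intersection then having \<open>(n - 4)!\<close>
  elements. So two prefix forms \<open>x \<noteq> y\<close> and two suffix forms \<open>z \<noteq> w\<close> cover
  \<open>4 (n - 2)! - m (n - 4)!\<close> nodes, where \<open>m\<close> is the number of symbol-disjoint pairs among them.
  For fixed \<open>x, y\<close> classify the suffix forms by the number \<open>0, 1, 2\<close> of members of \<open>{x, y}\<close> from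
  which they are symbol-disjoint: the class sizes depend only on the number \<open>t = 2, 3, 4\<close> of symbols
  occurring in \<open>x\<close> and \<open>y\<close>, and for given \<open>x\<close> there are \<open>1\<close>, \<open>4 (n - 2)\<close> and
  \<open>(n - 2) (n - 3)\<close> choices of \<open>y\<close> for these values of \<open>t\<close>.
\<close>

section \<open>Ordered and unordered pairs of distinct elements, and sums over them\<close>

definition arrangements :: "nat set \<Rightarrow> (nat \<times> nat) set" where
  "arrangements A = {(a, b). a \<in> A \<and> b \<in> A \<and> a \<noteq> b}"

definition symbols :: "nat \<times> nat \<Rightarrow> nat set" where
  "symbols z = {fst z, snd z}"

definition pairs_of :: "'a set \<Rightarrow> 'a set set" where
  "pairs_of A = {X. X \<subseteq> A \<and> card X = 2}"

lemma finite_arrangements [simp]: "finite A \<Longrightarrow> finite (arrangements A)"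
  by (rule finite_subset[of _ "A \<times> A"]) (auto simp: arrangements_def)

lemma finite_pairs_of [simp]: "finite A \<Longrightarrow> finite (pairs_of A)"
  by (simp add: pairs_of_def)

lemma arrangements_image:
  "{f a b | a b. a \<in> A \<and> b \<in> A \<and> a \<noteq> b} = (\<lambda>z. f (fst z) (snd z)) ` arrangements A"
  by (force simp: arrangements_def)

lemma card_arrangements:
  assumes "finite A"
  shows "real (card (arrangements A)) = real (card A) * (real (card A) - 1)"
proof -
  \<comment> \<open>Adjoining the diagonal completes the pairs of distinct elements to the full
    square.\<close>
  have "card (A \<times> A) = card (arrangements A \<union> (\<lambda>a. (a, a)) ` A)"
    by (rule arg_cong[where f = card]) (auto simp: arrangements_def)
  also have "\<dots> = card (arrangements A) + card ((\<lambda>a. (a, a)) ` A)"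
    using assms by (intro card_Un_disjoint finite_arrangements) (auto simp: arrangements_def)
  also have "card ((\<lambda>a. (a, a)) ` A) = card A"
    by (simp add: card_image inj_on_def)
  finally have "real (card A) * real (card A) = real (card (arrangements A)) + real (card A)"
    unfolding card_cartesian_product by (simp flip: of_nat_add of_nat_mult)
  then show ?thesis by (simp add: algebra_simps)
qed

text \<open>Sending an ordered pair of distinct elements to the set of its entries is a map all of
  whose fibres have size 2.\<close>

lemma sum_pairs_of:
  fixes f :: "'a set \<Rightarrow> real"
  assumes "finite A"
  shows "(\<Sum>X\<in>pairs_of A. f X) = (\<Sum>x\<in>A. \<Sum>y\<in>A - {x}. f {x, y}) / 2"
proof -
  let ?O = "Sigma A (\<lambda>x. A - {x})"
  let ?g = "\<lambda>(x, y). {x, y}"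
  have "(\<Sum>x\<in>A. \<Sum>y\<in>A - {x}. f {x, y}) = (\<Sum>z\<in>?O. f (?g z))"
    using assms by (subst sum.Sigma) (auto simp: case_prod_unfold)
  also have "\<dots> = (\<Sum>X\<in>pairs_of A. \<Sum>z\<in>{z \<in> ?O. ?g z = X}. f (?g z))"
    using assms by (intro sum.group[symmetric]) (auto simp: pairs_of_def)
  also have "\<dots> = (\<Sum>X\<in>pairs_of A. 2 * f X)"
  proof (rule sum.cong[OF refl])
    fix X assume "X \<in> pairs_of A"
    then obtain a b where ab: "X = {a, b}" "a \<noteq> b" "a \<in> A" "b \<in> A"
      by (auto simp: pairs_of_def card_2_iff)
    then have "{z \<in> ?O. ?g z = X} = {(a, b), (b, a)}"
      by (auto simp: doubleton_eq_iff)
    with ab show "(\<Sum>z\<in>{z \<in> ?O. ?g z = X}. f (?g z)) = 2 * f X"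
      by (simp add: insert_commute)
  qed
  finally show ?thesis by (simp add: sum_distrib_left[symmetric])
qed

lemma sum_by_value:
  fixes h :: "nat \<Rightarrow> real"
  assumes "finite A" "finite T" "\<And>z. z \<in> A \<Longrightarrow> d z \<in> T"
  shows "(\<Sum>z\<in>A. h (d z)) = (\<Sum>i\<in>T. real (card {z \<in> A. d z = i}) * h i)"
proof -
  have "(\<Sum>z\<in>A. h (d z)) = (\<Sum>i\<in>T. \<Sum>z\<in>{z \<in> A. d z = i}. h (d z))"
    using assms by (intro sum.group[symmetric]) auto
  then show ?thesis by simp
qed

lemma sum_atMost_2: "(\<Sum>i\<le>2. h i) = h 0 + h 1 + (h (2::nat) :: real)"
  by (simp add: numeral_2_eq_2)

text \<open>
  Here \<open>k0, k1, k2\<close> are the sizes of the classes of suffix forms for \<open>N\<close> symbols, and the sum runs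
  over the ordered pairs of distinct suffix forms, weighted by \<open>q m\<close>.
\<close>

definition pair_sum :: "real \<Rightarrow> (nat \<Rightarrow> real) \<Rightarrow> real \<Rightarrow> real" where
  "pair_sum N q t =
    (let k2 = (N - t) * (N - t - 1); k1 = 2 * ((N - 2) * (N - 3) - k2);
         k0 = N * (N - 1) - k1 - k2
     in k0 * (k0 - 1) * q 0 + 2 * k0 * k1 * q 1 + (2 * k0 * k2 + k1 * (k1 - 1)) * q 2
        + 2 * k1 * k2 * q 3 + k2 * (k2 - 1) * q 4)"

text \<open>The left side counts ordered data: \<open>N * (N - 1)\<close> choices of
  \<open>x\<close>, then the choices of \<open>y\<close> for \<open>t = 2, 3, 4\<close>. Since both
  pairs are ordered, the coefficients are four times those of the theorem. The weights
  \<open>q m\<close> are arbitrary, so this is a polynomial identity in \<open>N\<close> for each of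
  them.\<close>

lemma weighted_pair_sums:
  "N * (N - 1) * (pair_sum N q 2 + 4 * (N - 2) * pair_sum N q 3
      + (N - 2) * (N - 3) * pair_sum N q 4) =
    2 * (8 * N ^ 5 + 8 * N ^ 4 - 174 * N ^ 3 + 347 * N ^ 2 - 189 * N) * q 0
    + 64 * (3 * N ^ 5 - 25 * N ^ 4 + 75 * N ^ 3 - 95 * N ^ 2 + 42 * N) * q 1
    + 16 * (6 * N ^ 6 - 73 * N ^ 5 + 345 * N ^ 4 - 785 * N ^ 3 + 849 * N ^ 2 - 342 * N) * q 2
    + 8 * (2 * N ^ 7 - 33 * N ^ 6 + 223 * N ^ 5 - 785 * N ^ 4 + 1503 * N ^ 3 - 1462 * N ^ 2
        + 552 * N) * q 3
    + (N ^ 8 - 20 * N ^ 7 + 172 * N ^ 6 - 822 * N ^ 5 + 2340 * N ^ 4 - 3916 * N ^ 3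
        + 3499 * N ^ 2 - 1254 * N) * q 4"
proof -
  \<comment> \<open>The values of \<open>(k0, k1)\<close> are \<open>(4 * N - 6, 0)\<close> for
    \<open>t = 2\<close>, \<open>(2 * N, 4 * (N - 3))\<close> for \<open>t = 3\<close> and
    \<open>(8, 8 * N - 28)\<close> for \<open>t = 4\<close>. For \<open>t = 2\<close> both members
    have the same symbols, so nothing avoids exactly one of them.\<close>
  have S2: "pair_sum N q 2 = (4 * N - 6) * (4 * N - 7) * q 0
      + 2 * (4 * N - 6) * (N - 2) * (N - 3) * q 2
      + (N - 2) * (N - 3) * ((N - 2) * (N - 3) - 1) * q 4"
    unfolding pair_sum_def Let_def by algebra
  have S3: "pair_sum N q 3 = 2 * N * (2 * N - 1) * q 0 + 16 * N * (N - 3) * q 1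
      + (4 * N * (N - 3) * (N - 4) + 4 * (N - 3) * (4 * N - 13)) * q 2
      + 8 * (N - 3) * (N - 3) * (N - 4) * q 3
      + (N - 3) * (N - 4) * ((N - 3) * (N - 4) - 1) * q 4"
    unfolding pair_sum_def Let_def by algebra
  have S4: "pair_sum N q 4 = 56 * q 0 + 16 * (8 * N - 28) * q 1
      + (16 * (N - 4) * (N - 5) + (8 * N - 28) * (8 * N - 29)) * q 2
      + 2 * (8 * N - 28) * (N - 4) * (N - 5) * q 3
      + (N - 4) * (N - 5) * ((N - 4) * (N - 5) - 1) * q 4"
    unfolding pair_sum_def Let_def by algebra
  show ?thesis unfolding S2 S3 S4 by algebra
qed

section \<open>Fault-free events, and permutations with two symbols split off\<close>

lemma prob_fault_free:
  assumes "0 \<le> p" "p \<le> 1" "U \<subseteq> permutations_of_set {1..n}"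
  shows "measure_pmf.prob (node_fault_model n p) {\<omega>. \<forall>u\<in>U. \<omega> u} = p ^ card U"
proof -
  let ?V = "permutations_of_set {1..n}"
  \<comment> \<open>The event is a box: it constrains the coordinates in \<open>U\<close> to
    \<open>True\<close> and leaves the other nodes free, so independence gives a product.\<close>
  have "{\<omega>. \<forall>u\<in>U. \<omega> u} = Pi ?V (\<lambda>u. if u \<in> U then {True} else UNIV)"
    using assms(3) by (auto simp: Pi_def)
  then have "measure_pmf.prob (node_fault_model n p) {\<omega>. \<forall>u\<in>U. \<omega> u} =
      (\<Prod>u\<in>?V. measure_pmf.prob (bernoulli_pmf p) (if u \<in> U then {True} else UNIV))"
    by (simp add: node_fault_model_def bubble_sort_network_def measure_Pi_pmf_Pi)
  also have "\<dots> = (\<Prod>u\<in>?V. if u \<in> U then p else 1)"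
    using assms by (intro prod.cong) (auto simp: measure_pmf_single)
  also have "\<dots> = p ^ card U"
    using assms(3) by (simp add: prod.If_cases Int_absorb1)
  finally show ?thesis .
qed

lemma Cons_Cons_in_permutations_of_set:
  "a # b # xs \<in> permutations_of_set A \<longleftrightarrow>
    a \<in> A \<and> b \<in> A \<and> a \<noteq> b \<and> xs \<in> permutations_of_set (A - {a, b})"
  by (auto simp: permutations_of_set_def)

lemma append_two_in_permutations_of_set:
  "xs @ [a, b] \<in> permutations_of_set A \<longleftrightarrow>
    a \<in> A \<and> b \<in> A \<and> a \<noteq> b \<and> xs \<in> permutations_of_set (A - {a, b})"
  by (auto simp: permutations_of_set_def)

section \<open>Prefix and suffix forms: sizes, intersections and unions\<close>

context
  fixes n :: nat
  assumes n: "n \<ge> 4"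
begin

definition pre :: "nat \<times> nat \<Rightarrow> nat list set" where
  "pre z = prefix_subnetwork n (fst z) (snd z)"

definition suf :: "nat \<times> nat \<Rightarrow> nat list set" where
  "suf z = suffix_subnetwork n (fst z) (snd z)"

abbreviation "D \<equiv> arrangements {1..n}"

lemma prefix_forms_eq: "prefix_forms n = pre ` D"
  unfolding prefix_forms_def pre_def by (rule arrangements_image)

lemma suffix_forms_eq: "suffix_forms n = suf ` D"
  unfolding suffix_forms_def suf_def by (rule arrangements_image)

text \<open>Deleting the two fixed symbols leaves an arbitrary permutation of the others. As the
  reverse map is injective, this image form gives the size.\<close>

lemma pre_eq:
  assumes "z \<in> D"
  shows "pre z = (\<lambda>xs. fst z # snd z # xs) ` permutations_of_set ({1..n} - symbols z)"
proof (intro equalityI subsetI)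
  fix u assume "u \<in> pre z"
  then have u: "u \<in> permutations_of_set {1..n}" "u ! 0 = fst z" "u ! 1 = snd z"
    by (simp_all add: pre_def prefix_subnetwork_def bubble_sort_network_def)
  then have "length u \<ge> 2"
    using n length_finite_permutations_of_set[OF u(1)] by simp
  then obtain a b xs where "u = a # b # xs"
    by (metis Suc_le_length_iff numeral_2_eq_2)
  with u have "u = fst z # snd z # xs" by simp
  with u(1) show "u \<in> (\<lambda>xs. fst z # snd z # xs) ` permutations_of_set ({1..n} - symbols z)"
    by (simp only: Cons_Cons_in_permutations_of_set symbols_def) blast
next
  fix u assume "u \<in> (\<lambda>xs. fst z # snd z # xs) ` permutations_of_set ({1..n} - symbols z)"
  then obtain xs where xs: "u = fst z # snd z # xs"
      "xs \<in> permutations_of_set ({1..n} - {fst z, snd z})" by (auto simp: symbols_def)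
  with assms have "u \<in> permutations_of_set {1..n}"
    unfolding xs(1) Cons_Cons_in_permutations_of_set by (auto simp: arrangements_def)
  then show "u \<in> pre z"
    using xs(1) by (simp add: pre_def prefix_subnetwork_def bubble_sort_network_def)
qed

lemma suf_eq:
  assumes "z \<in> D"
  shows "suf z = (\<lambda>xs. xs @ [fst z, snd z]) ` permutations_of_set ({1..n} - symbols z)"
proof (intro equalityI subsetI)
  fix u assume "u \<in> suf z"
  then have u: "u \<in> permutations_of_set {1..n}" "u ! (n - 2) = fst z" "u ! (n - 1) = snd z"
    by (simp_all add: suf_def suffix_subnetwork_def bubble_sort_network_def)
  have len: "length u = n"
    using length_finite_permutations_of_set[OF u(1)] by simp
  \<comment> \<open>The last two symbols are peeled off the end of \<open>u\<close> one at a
    time.\<close>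
  have "drop (n - 2) u = u ! (n - 2) # drop (Suc (n - 2)) u"
    using n len by (intro Cons_nth_drop_Suc[symmetric]) simp
  also have "Suc (n - 2) = n - 1" using n by simp
  also have "drop (n - 1) u = u ! (n - 1) # drop (Suc (n - 1)) u"
    using n len by (intro Cons_nth_drop_Suc[symmetric]) simp
  finally have "drop (n - 2) u = [fst z, snd z]" using u n len by simp
  then obtain xs where "u = xs @ [fst z, snd z]" by (metis append_take_drop_id)
  with u(1) show "u \<in> (\<lambda>xs. xs @ [fst z, snd z]) ` permutations_of_set ({1..n} - symbols z)"
    by (simp only: append_two_in_permutations_of_set symbols_def) blast
next
  fix u assume "u \<in> (\<lambda>xs. xs @ [fst z, snd z]) ` permutations_of_set ({1..n} - symbols z)"
  then obtain xs where xs: "u = xs @ [fst z, snd z]"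
      "xs \<in> permutations_of_set ({1..n} - {fst z, snd z})" by (auto simp: symbols_def)
  with assms have u: "u \<in> permutations_of_set {1..n}"
    unfolding xs(1) append_two_in_permutations_of_set by (auto simp: arrangements_def)
  then have "n - 2 = length xs" "n - 1 = Suc (length xs)"
    using xs(1) length_finite_permutations_of_set[OF u] by simp_all
  with u show "u \<in> suf z"
    using xs(1) by (simp add: suf_def suffix_subnetwork_def bubble_sort_network_def nth_append)
qed

lemma card_symbols: "z \<in> D \<Longrightarrow> card (symbols z) = 2"
  by (auto simp: symbols_def arrangements_def)

lemma finite_symbols [simp]: "finite (symbols z)"
  by (simp add: symbols_def)

lemma symbols_subset: "z \<in> D \<Longrightarrow> symbols z \<subseteq> {1..n}"
  by (auto simp: symbols_def arrangements_def)

lemma card_remaining: "T \<subseteq> {1..n} \<Longrightarrow> card ({1..n} - T) = n - card T"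
  by (simp add: card_Diff_subset finite_subset)

lemma card_pre: "z \<in> D \<Longrightarrow> card (pre z) = fact (n - 2)"
  by (simp add: pre_eq card_image inj_on_def card_remaining symbols_subset card_symbols
      del: One_nat_def)

lemma card_suf: "z \<in> D \<Longrightarrow> card (suf z) = fact (n - 2)"
  by (simp add: suf_eq card_image inj_on_def card_remaining symbols_subset card_symbols
      del: One_nat_def)

lemma pre_suf_subset: "pre z \<subseteq> permutations_of_set {1..n}" "suf z \<subseteq> permutations_of_set {1..n}"
  by (auto simp: pre_def suf_def prefix_subnetwork_def suffix_subnetwork_def bubble_sort_network_def)

lemma finite_pre [simp]: "finite (pre z)" and finite_suf [simp]: "finite (suf z)"
  using pre_suf_subset[of z] finite_subset[OF _ finite_permutations_of_set] by blast+

lemma pre_disjoint: "x \<noteq> y \<Longrightarrow> pre x \<inter> pre y = {}"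
  by (auto simp: pre_def prefix_subnetwork_def prod_eq_iff)

lemma suf_disjoint: "x \<noteq> y \<Longrightarrow> suf x \<inter> suf y = {}"
  by (auto simp: suf_def suffix_subnetwork_def prod_eq_iff)

text \<open>Because \<open>n \<ge> 4\<close>, the first two and the last two positions do not
  overlap, and exactly the middle \<open>n - 4\<close> positions remain free.\<close>

lemma pre_Int_suf:
  assumes "x \<in> D" "z \<in> D" "symbols x \<inter> symbols z = {}"
  shows "pre x \<inter> suf z = (\<lambda>xs. fst x # snd x # xs @ [fst z, snd z]) `
    permutations_of_set ({1..n} - (symbols x \<union> symbols z))"
proof (intro equalityI subsetI)
  fix u assume u: "u \<in> pre x \<inter> suf z"
  then have U: "u \<in> permutations_of_set {1..n}" using pre_suf_subset by blast
  obtain xs where xs: "u = fst x # snd x # xs" using u pre_eq[OF assms(1)] by auto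
  obtain ys where ys: "u = ys @ [fst z, snd z]" using u suf_eq[OF assms(2)] by auto
  have "length ys \<ge> 2"
    using n ys length_finite_permutations_of_set[OF U] by simp
  then obtain a b zs where "ys = a # b # zs"
    by (metis Suc_le_length_iff numeral_2_eq_2)
  with xs ys have eq: "u = fst x # snd x # (zs @ [fst z, snd z])" by simp
  have "zs \<in> permutations_of_set ({1..n} - {fst x, snd x} - {fst z, snd z})"
    using U unfolding eq Cons_Cons_in_permutations_of_set append_two_in_permutations_of_set
    by blast
  moreover have "{1..n} - {fst x, snd x} - {fst z, snd z} = {1..n} - (symbols x \<union> symbols z)"
    by (auto simp: symbols_def)
  ultimately show "u \<in> (\<lambda>xs. fst x # snd x # xs @ [fst z, snd z]) `
      permutations_of_set ({1..n} - (symbols x \<union> symbols z))"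
    unfolding eq by (metis imageI)
next
  fix u assume "u \<in> (\<lambda>xs. fst x # snd x # xs @ [fst z, snd z]) `
    permutations_of_set ({1..n} - (symbols x \<union> symbols z))"
  then obtain xs where xs: "u = fst x # snd x # xs @ [fst z, snd z]"
    "xs \<in> permutations_of_set ({1..n} - (symbols x \<union> symbols z))" by blast
  \<comment> \<open>The remaining symbols are written in two ways, one for membership in the suffix
    form and one for membership in the prefix form.\<close>
  have "{1..n} - (symbols x \<union> symbols z) = {1..n} - symbols x - {fst z, snd z}"
    "{1..n} - (symbols x \<union> symbols z) = {1..n} - symbols z - {fst x, snd x}"
    by (auto simp: symbols_def)
  moreover have "fst x \<in> {1..n} - symbols z" "snd x \<in> {1..n} - symbols z" "fst x \<noteq> snd x"
    "fst z \<in> {1..n} - symbols x" "snd z \<in> {1..n} - symbols x" "fst z \<noteq> snd z"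
    using assms by (auto simp: arrangements_def symbols_def)
  ultimately have "xs @ [fst z, snd z] \<in> permutations_of_set ({1..n} - symbols x)"
    "fst x # snd x # xs \<in> permutations_of_set ({1..n} - symbols z)"
    using xs(2) unfolding Cons_Cons_in_permutations_of_set append_two_in_permutations_of_set
    by metis+
  moreover have "u = (fst x # snd x # xs) @ [fst z, snd z]" using xs(1) by simp
  ultimately show "u \<in> pre x \<inter> suf z"
    using xs(1) unfolding pre_eq[OF assms(1)] suf_eq[OF assms(2)] by (metis IntI imageI)
qed

text \<open>A number rather than a truth value, so that four of these add up to the number
  \<open>m\<close> of symbol-disjoint pairs.\<close>

definition disj_ind :: "nat \<times> nat \<Rightarrow> nat \<times> nat \<Rightarrow> nat" where
  "disj_ind x z = (if symbols x \<inter> symbols z = {} then 1 else 0)"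

lemma card_pre_Int_suf:
  assumes "x \<in> D" "z \<in> D"
  shows "card (pre x \<inter> suf z) = disj_ind x z * fact (n - 4)"
proof (cases "symbols x \<inter> symbols z = {}")
  case True
  have "card (symbols x \<union> symbols z) = 4"
    using True assms by (simp add: card_Un_disjoint card_symbols)
  then show ?thesis
    using True assms
    by (simp add: disj_ind_def pre_Int_suf card_image inj_on_def card_remaining symbols_subset
        del: One_nat_def)
next
  case False
  have "pre x \<inter> suf z = {}"
  proof (rule ccontr)
    assume "pre x \<inter> suf z \<noteq> {}"
    then obtain u where u: "u \<in> pre x" "u \<in> suf z" by blast
    then have d: "distinct u" "length u = n"
      using pre_suf_subset(1)[of x] length_finite_permutations_of_set[of u "{1..n}"]
      by (auto simp: permutations_of_set_def)
    from u have "symbols x = {u ! 0, u ! 1}" "symbols z = {u ! (n - 2), u ! (n - 1)}"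
      by (auto simp: pre_def suf_def symbols_def prefix_subnetwork_def suffix_subnetwork_def)
    \<comment> \<open>The indices \<open>0\<close>, \<open>1\<close>, \<open>n - 2\<close>,
      \<open>n - 1\<close> are distinct for \<open>n \<ge> 4\<close>, so a common permutation would
      force the symbol sets to be disjoint.\<close>
    with d n False show False by (auto simp: nth_eq_iff_index_eq)
  qed
  with False show ?thesis by (simp add: disj_ind_def)
qed

text \<open>Forms of the same kind are disjoint, so inclusion-exclusion is needed only between the
  prefix part and the suffix part. Grouping the indicators by \<open>z\<close> and \<open>w\<close>
  makes \<open>m\<close> a sum of one term for each suffix form. The subtraction is not truncated,
  since what is removed is the size of an intersection.\<close>

lemma card_union4:
  assumes "x \<in> D" "y \<in> D" "z \<in> D" "w \<in> D" "x \<noteq> y" "z \<noteq> w"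
  shows "card (pre x \<union> pre y \<union> (suf z \<union> suf w)) =
    4 * fact (n - 2) - ((disj_ind x z + disj_ind y z) + (disj_ind x w + disj_ind y w)) * fact (n - 4)"
proof -
  let ?A = "pre x \<union> pre y" and ?B = "suf z \<union> suf w"
  have A: "card ?A = 2 * fact (n - 2)"
    using assms by (simp add: card_Un_disjoint pre_disjoint card_pre)
  have B: "card ?B = 2 * fact (n - 2)"
    using assms by (simp add: card_Un_disjoint suf_disjoint card_suf)
  \<comment> \<open>The four mixed intersections are pairwise disjoint, hence their sizes
    add.\<close>
  have "?A \<inter> ?B = ((pre x \<inter> suf z) \<union> (pre x \<inter> suf w)) \<union> ((pre y \<inter> suf z) \<union> (pre y \<inter> suf w))"
    by blast
  also have "card \<dots> = (card (pre x \<inter> suf z) + card (pre x \<inter> suf w)) +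
      (card (pre y \<inter> suf z) + card (pre y \<inter> suf w))"
  proof -
    have *: "pre v \<inter> suf z \<inter> (pre v \<inter> suf w) = {}" for v
      using suf_disjoint[OF assms(6)] by blast
    have "(pre x \<inter> suf z \<union> pre x \<inter> suf w) \<inter> (pre y \<inter> suf z \<union> pre y \<inter> suf w) = {}"
      using pre_disjoint[OF assms(5)] by blast
    then show ?thesis by (simp add: card_Un_disjoint *)
  qed
  also have "\<dots> = ((disj_ind x z + disj_ind y z) + (disj_ind x w + disj_ind y w)) * fact (n - 4)"
    unfolding card_pre_Int_suf[OF assms(1,3)] card_pre_Int_suf[OF assms(1,4)]
      card_pre_Int_suf[OF assms(2,3)] card_pre_Int_suf[OF assms(2,4)] by (simp add: distrib_right)
  finally have "card (?A \<inter> ?B) =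
      ((disj_ind x z + disj_ind y z) + (disj_ind x w + disj_ind y w)) * fact (n - 4)" .
  moreover have "card ?A + card ?B = card (?A \<union> ?B) + card (?A \<inter> ?B)"
    by (intro card_Un_Int) auto
  ultimately show ?thesis unfolding A B by linarith
qed

section \<open>Disjointness of the three families of forms\<close>

lemma exists_remaining:
  assumes "card T \<le> 3" "finite T"
  obtains c where "c \<in> {1..n}" "c \<notin> T"
proof -
  have "\<not> {1..n} \<subseteq> T"
    using card_mono[of T "{1..n}"] n assms by fastforce
  with that show thesis by blast
qed

text \<open>Separates prefix forms from suffix and middle forms, all of which fix the last symbol.
  The witness lies in a suffix form \<open>(a, b)\<close> symbol-disjoint from \<open>x\<close> with
  \<open>b \<noteq> d\<close>; four symbols suffice to choose \<open>b\<close> and then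
  \<open>a\<close>.\<close>

lemma pre_last_free:
  assumes "x \<in> D"
  shows "\<exists>u\<in>pre x. u ! (n - 1) \<noteq> d"
proof -
  have "card {fst x, snd x, d} \<le> 3" by (simp add: card_insert_if)
  then obtain b where b: "b \<in> {1..n}" "b \<notin> {fst x, snd x, d}"
    using exists_remaining by blast
  have "card {fst x, snd x, b} \<le> 3" by (simp add: card_insert_if)
  then obtain a where a: "a \<in> {1..n}" "a \<notin> {fst x, snd x, b}"
    using exists_remaining by blast
  have "(a, b) \<in> D" using a b by (auto simp: arrangements_def)
  moreover have "disj_ind x (a, b) = 1" using a b by (auto simp: disj_ind_def symbols_def)
  ultimately have "card (pre x \<inter> suf (a, b)) \<noteq> 0"
    using assms by (simp add: card_pre_Int_suf)
  then obtain u where "u \<in> pre x" "u \<in> suf (a, b)"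
    by (metis card.empty disjoint_iff)
  with b show ?thesis by (auto simp: suf_def suffix_subnetwork_def)
qed

text \<open>Separates suffix forms from middle forms, which fix the first symbol. The witness lies
  in a symbol-disjoint prefix form \<open>(a, b)\<close> with \<open>a \<noteq> d\<close>.\<close>

lemma suf_first_free:
  assumes "x \<in> D"
  shows "\<exists>u\<in>suf x. u ! 0 \<noteq> d"
proof -
  have "card {fst x, snd x, d} \<le> 3" by (simp add: card_insert_if)
  then obtain a where a: "a \<in> {1..n}" "a \<notin> {fst x, snd x, d}"
    using exists_remaining by blast
  have "card {fst x, snd x, a} \<le> 3" by (simp add: card_insert_if)
  then obtain b where b: "b \<in> {1..n}" "b \<notin> {fst x, snd x, a}"
    using exists_remaining by blast
  have "(a, b) \<in> D" using a b by (auto simp: arrangements_def)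
  moreover have "disj_ind (a, b) x = 1" using a b by (auto simp: disj_ind_def symbols_def)
  ultimately have "card (pre (a, b) \<inter> suf x) \<noteq> 0"
    using assms by (simp add: card_pre_Int_suf)
  then obtain u where "u \<in> pre (a, b)" "u \<in> suf x"
    by (metis card.empty disjoint_iff)
  with a show ?thesis by (auto simp: pre_def prefix_subnetwork_def)
qed

lemma prefix_suffix_forms_disjoint: "pre ` D \<inter> suf ` D = {}"
proof -
  have "pre x \<noteq> suf z" if "x \<in> D" for x z
    using pre_last_free[OF that, of "snd z"] by (auto simp: suf_def suffix_subnetwork_def)
  then show ?thesis by auto
qed

lemma prefix_middle_forms_disjoint: "pre ` D \<inter> middle_forms n = {}"
proof -
  have "pre x \<noteq> middle_subnetwork n a b" if "x \<in> D" for x a b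
    using pre_last_free[OF that, of b] by (auto simp: middle_subnetwork_def)
  then show ?thesis by (auto simp: middle_forms_def)
qed

lemma suffix_middle_forms_disjoint: "suf ` D \<inter> middle_forms n = {}"
proof -
  have "suf x \<noteq> middle_subnetwork n a b" if "x \<in> D" for x a b
    using suf_first_free[OF that, of a] by (auto simp: middle_subnetwork_def)
  then show ?thesis by (auto simp: middle_forms_def)
qed

section \<open>Reindexing the sum by pairs of symbol pairs\<close>

lemma inj_on_pre: "inj_on pre D"
proof (rule inj_onI)
  fix x y assume "x \<in> D" "y \<in> D" "pre x = pre y"
  then show "x = y" using pre_disjoint[of x y] card_pre[of x] fact_nonzero[of "n - 2"]
    by (metis Int_absorb card.empty)
qed

lemma inj_on_suf: "inj_on suf D"
proof (rule inj_onI)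
  fix x y assume "x \<in> D" "y \<in> D" "suf x = suf y"
  then show "x = y" using suf_disjoint[of x y] card_suf[of x] fact_nonzero[of "n - 2"]
    by (metis Int_absorb card.empty)
qed

text \<open>A set \<open>S\<close> in the sum is determined by the two indices of its prefix forms
  and the two of its suffix forms. Injectivity of the indexing and disjointness of the families make
  this a bijection.\<close>

lemma P4_2_0_2_eq:
  assumes "0 \<le> p" "p \<le> 1"
  shows "P4 n p 2 0 2 =
    (\<Sum>A\<in>pairs_of D. \<Sum>B\<in>pairs_of D. p ^ card (\<Union>(pre ` A) \<union> \<Union>(suf ` B)))"
proof -
  let ?S = "{S. S \<subseteq> prefix_forms n \<union> middle_forms n \<union> suffix_forms n \<and> card S = 4 \<and>
    card (S \<inter> prefix_forms n) = 2 \<and> card (S \<inter> middle_forms n) = 0 \<and>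
    card (S \<inter> suffix_forms n) = 2}"
  let ?f = "\<lambda>S. measure_pmf.prob (node_fault_model n p) {\<omega>. \<forall>H\<in>S. fault_free \<omega> H}"
  let ?j = "\<lambda>(A, B). pre ` A \<union> suf ` B"
  let ?i = "\<lambda>S. ({z \<in> D. pre z \<in> S}, {z \<in> D. suf z \<in> S})"
  have i_j: "{z \<in> D. pre z \<in> pre ` A \<union> suf ` B} = A \<and> {z \<in> D. suf z \<in> pre ` A \<union> suf ` B} = B"
    if "A \<subseteq> D" "B \<subseteq> D" for A B
  proof -
    have "pre z \<notin> suf ` B" "suf z \<notin> pre ` A" if "z \<in> D" for z
      using that \<open>A \<subseteq> D\<close> \<open>B \<subseteq> D\<close> prefix_suffix_forms_disjoint by blast+
    moreover have "pre z \<in> pre ` A \<longleftrightarrow> z \<in> A" "suf z \<in> suf ` B \<longleftrightarrow> z \<in> B" if "z \<in> D" for z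
      using that \<open>A \<subseteq> D\<close> \<open>B \<subseteq> D\<close> inj_on_pre inj_on_suf by (simp_all add: inj_on_image_mem_iff)
    ultimately show ?thesis using that by blast
  qed
  have S_D: "S = pre ` {z \<in> D. pre z \<in> S} \<union> suf ` {z \<in> D. suf z \<in> S}"
    "card {z \<in> D. pre z \<in> S} = 2" "card {z \<in> D. suf z \<in> S} = 2" if "S \<in> ?S" for S
  proof -
    have P: "S \<inter> prefix_forms n = pre ` {z \<in> D. pre z \<in> S}"
      and Q: "S \<inter> suffix_forms n = suf ` {z \<in> D. suf z \<in> S}"
      by (auto simp: prefix_forms_eq suffix_forms_eq)
    \<comment> \<open>Infinite sets have \<open>card\<close> 0, so finiteness must come first: only
      then does cardinality 0 mean that \<open>S\<close> contains no middle form.\<close>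
    have fin: "finite S" using that by (intro card_ge_0_finite) simp
    then have "S \<inter> middle_forms n = {}" using that by simp
    then have "S = (S \<inter> prefix_forms n) \<union> (S \<inter> suffix_forms n)" using that by blast
    then show "S = pre ` {z \<in> D. pre z \<in> S} \<union> suf ` {z \<in> D. suf z \<in> S}" by (simp only: P Q)
    show "card {z \<in> D. pre z \<in> S} = 2" "card {z \<in> D. suf z \<in> S} = 2"
      using that card_image[OF inj_on_subset[OF inj_on_pre], of "{z \<in> D. pre z \<in> S}"]
        card_image[OF inj_on_subset[OF inj_on_suf], of "{z \<in> D. suf z \<in> S}"]
      unfolding mem_Collect_eq P Q by simp_all
  qed
  have j_mem: "pre ` A \<union> suf ` B \<in> ?S" if "A \<in> pairs_of D" "B \<in> pairs_of D" for A B
  proof -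
    have AB: "A \<subseteq> D" "B \<subseteq> D" "card A = 2" "card B = 2" using that by (auto simp: pairs_of_def)
    then have "finite A" "finite B" by (auto intro: card_ge_0_finite)
    \<comment> \<open>\<open>P\<close>, \<open>Q\<close>, \<open>M\<close> stand for the prefix,
      suffix and middle families, \<open>X\<close> and \<open>Y\<close> for the chosen
      members.\<close>
    have "(X \<union> Y) \<inter> P = X \<and> (X \<union> Y) \<inter> Q = Y \<and> (X \<union> Y) \<inter> M = {} \<and> X \<inter> Y = {}"
      if "X \<subseteq> P" "Y \<subseteq> Q" "P \<inter> Q = {}" "P \<inter> M = {}" "Q \<inter> M = {}"
      for X Y P Q M :: "nat list set set"
      using that by blast
    note * = this[OF image_mono[OF AB(1)] image_mono[OF AB(2)] prefix_suffix_forms_disjoint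
      prefix_middle_forms_disjoint suffix_middle_forms_disjoint]
    have "card (pre ` A) = 2" "card (suf ` B) = 2"
      using AB card_image[OF inj_on_subset[OF inj_on_pre AB(1)]]
        card_image[OF inj_on_subset[OF inj_on_suf AB(2)]] by simp_all
    moreover have "pre ` A \<union> suf ` B \<subseteq> prefix_forms n \<union> middle_forms n \<union> suffix_forms n"
      unfolding prefix_forms_eq suffix_forms_eq using AB by (intro Un_mono image_mono le_supI1) auto
    ultimately show ?thesis
      using * \<open>finite A\<close> \<open>finite B\<close>
      by (simp add: card_Un_disjoint prefix_forms_eq suffix_forms_eq del: One_nat_def)
  qed
  have "P4 n p 2 0 2 = (\<Sum>S\<in>?S. ?f S)"
    by (simp add: P4_def)
  also have "\<dots> = (\<Sum>(A, B)\<in>pairs_of D \<times> pairs_of D. p ^ card (\<Union>(pre ` A) \<union> \<Union>(suf ` B)))"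
  proof (rule sum.reindex_bij_witness[where i = ?j and j = ?i])
    fix S assume S: "S \<in> ?S"
    note D = S_D[OF S]
    show "?j (?i S) = S" using D(1)[symmetric] by (simp only: prod.case)
    show "?i S \<in> pairs_of D \<times> pairs_of D" using D(2,3) by (simp add: pairs_of_def)
    \<comment> \<open>All members of \<open>S\<close> are fault-free iff all nodes of their union
      are.\<close>
    have "{\<omega>. \<forall>H\<in>S. fault_free \<omega> H} = {\<omega>. \<forall>u\<in>\<Union>S. \<omega> u}" by (auto simp: fault_free_def)
    moreover have "\<Union>S = \<Union>(pre ` {z \<in> D. pre z \<in> S}) \<union> \<Union>(suf ` {z \<in> D. suf z \<in> S})"
      by (subst D(1)) blast
    moreover from this have "\<Union>S \<subseteq> permutations_of_set {1..n}"
      using pre_suf_subset by blast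
    ultimately show "(case ?i S of (A, B) \<Rightarrow> p ^ card (\<Union>(pre ` A) \<union> \<Union>(suf ` B))) = ?f S"
      using prob_fault_free[OF assms] by simp
  next
    fix AB assume AB: "AB \<in> pairs_of D \<times> pairs_of D"
    then obtain A B where "AB = (A, B)" "A \<in> pairs_of D" "B \<in> pairs_of D" by blast
    moreover from this have "A \<subseteq> D" "B \<subseteq> D" by (simp_all add: pairs_of_def)
    ultimately show "?j AB \<in> ?S" "?i (?j AB) = AB"
      using j_mem[of A B] i_j[of A B] by (simp_all only: prod.case)
  qed
  also have "\<dots> = (\<Sum>A\<in>pairs_of D. \<Sum>B\<in>pairs_of D. p ^ card (\<Union>(pre ` A) \<union> \<Union>(suf ` B)))"
    by (simp add: sum.cartesian_product)
  finally show ?thesis .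
qed

section \<open>Class sizes of suffix forms and of second prefix forms\<close>

lemma card_avoiding:
  assumes "T \<subseteq> {1..n}"
  shows "real (card {z \<in> D. symbols z \<inter> T = {}}) = (real n - card T) * (real n - card T - 1)"
proof -
  have "{z \<in> D. symbols z \<inter> T = {}} = arrangements ({1..n} - T)"
    by (auto simp: arrangements_def symbols_def)
  moreover have "card T \<le> n" using card_mono[OF _ assms] by simp
  ultimately show ?thesis
    using assms by (simp add: card_arrangements card_remaining of_nat_diff del: One_nat_def)
qed

text \<open>The exponent depends on \<open>z\<close> and \<open>w\<close> only through
  \<open>d z\<close> and \<open>d w\<close>, so the double sum splits by the sizes
  \<open>k 0\<close>, \<open>k 1\<close>, \<open>k 2\<close> of the level sets of
  \<open>d\<close>.\<close>

lemma sum_disj_ind: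
  assumes "x \<in> D" "y \<in> D"
  shows "(\<Sum>z\<in>D. \<Sum>w\<in>D - {z}. q (disj_ind x z + disj_ind y z + (disj_ind x w + disj_ind y w))) =
    pair_sum (real n) q (card (symbols x \<union> symbols y))"
proof -
  define d where "d z = disj_ind x z + disj_ind y z" for z
  define k where "k i = real (card {z \<in> D. d z = i})" for i
  define t where "t = card (symbols x \<union> symbols y)"
  let ?N = "real n"
  have by_value: "(\<Sum>z\<in>D. h (d z)) = k 0 * h 0 + k 1 * h 1 + k 2 * h 2" for h
    using sum_by_value[of D "{..2}" d h]
    by (simp add: sum_atMost_2 k_def) (auto simp: d_def disj_ind_def)
  have avoid: "(\<Sum>z\<in>D. real (disj_ind v z)) = (?N - 2) * (?N - 3)" if "v \<in> D" for v
  proof -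
    have "(\<Sum>z\<in>D. real (disj_ind v z)) = (\<Sum>z\<in>{z \<in> D. symbols z \<inter> symbols v = {}}. 1)"
      unfolding disj_ind_def
      by (subst sum.inter_filter) (auto simp: Int_commute intro!: sum.cong)
    then show ?thesis
      using card_avoiding[OF symbols_subset[OF that]]
      by (simp add: card_symbols[OF that] del: One_nat_def)
  qed
  have "{z \<in> D. d z = 2} = {z \<in> D. symbols z \<inter> (symbols x \<union> symbols y) = {}}"
    by (auto simp: d_def disj_ind_def split: if_splits)
  then have k2: "k 2 = (?N - t) * (?N - t - 1)"
    using card_avoiding[of "symbols x \<union> symbols y"] symbols_subset assms
    by (simp add: k_def t_def)
  \<comment> \<open>Double counting: this sum equals \<open>k 1 + 2 * k 2\<close>, while each of
    \<open>x\<close> and \<open>y\<close> is avoided by \<open>(n - 2) * (n - 3)\<close>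
    forms.\<close>
  have "(\<Sum>z\<in>D. real (d z)) = 2 * ((?N - 2) * (?N - 3))"
    using avoid assms by (simp add: d_def sum.distrib)
  then have k1: "k 1 = 2 * ((?N - 2) * (?N - 3) - k 2)"
    using by_value[of real] by (simp add: algebra_simps)
  have "real (card D) = ?N * (?N - 1)"
    by (simp add: card_arrangements)
  then have k0: "k 0 = ?N * (?N - 1) - k 1 - k 2"
    using by_value[of "\<lambda>_. 1"] by simp
  \<comment> \<open>The excluded diagonal \<open>w = z\<close> contributes
    \<open>q (2 * d z)\<close>.\<close>
  have "(\<Sum>z\<in>D. \<Sum>w\<in>D - {z}. q (d z + d w)) = (\<Sum>z\<in>D. (\<Sum>w\<in>D. q (d z + d w)) - q (2 * d z))"
    by (intro sum.cong refl) (simp add: sum_diff1 mult_2)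
  also have "\<dots> = (\<Sum>z\<in>D. k 0 * q (d z) + k 1 * q (d z + 1) + k 2 * q (d z + 2) - q (2 * d z))"
  proof (rule sum.cong[OF refl])
    fix z
    show "(\<Sum>w\<in>D. q (d z + d w)) - q (2 * d z) =
        k 0 * q (d z) + k 1 * q (d z + 1) + k 2 * q (d z + 2) - q (2 * d z)"
      using by_value[of "\<lambda>i. q (d z + i)"] by simp
  qed
  also have "\<dots> = k 0 * (k 0 * q 0 + k 1 * q 1 + k 2 * q 2 - q 0)
      + k 1 * (k 0 * q 1 + k 1 * q 2 + k 2 * q 3 - q 2)
      + k 2 * (k 0 * q 2 + k 1 * q 3 + k 2 * q 4 - q 4)"
    using by_value[of "\<lambda>i. k 0 * q i + k 1 * q (i + 1) + k 2 * q (i + 2) - q (2 * i)"]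
    by (simp add: numeral_eq_Suc)
  also have "\<dots> = pair_sum (real n) q t"
    unfolding pair_sum_def Let_def k2[symmetric] k1[symmetric] k0[symmetric]
    by (simp add: algebra_simps)
  finally show ?thesis by (simp add: d_def t_def)
qed

lemma sum_symbol_unions:
  assumes x: "x \<in> D"
  shows "(\<Sum>y\<in>D - {x}. h (card (symbols x \<union> symbols y))) =
    h 2 + 4 * (real n - 2) * h 3 + (real n - 2) * (real n - 3) * h 4"
proof -
  define d where "d y = card (symbols x \<union> symbols y)" for y
  define k where "k i = real (card {y \<in> D. d y = i})" for i
  have d_Int: "d y + card (symbols x \<inter> symbols y) = 4" if "y \<in> D" for y
    using card_Un_Int[of "symbols x" "symbols y"] card_symbols[OF x] card_symbols[OF that]
    by (simp add: d_def)
  have d_ge: "2 \<le> d y" for y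
    using card_mono[of "symbols x \<union> symbols y" "symbols x"] card_symbols[OF x] by (simp add: d_def)
  have "d y \<in> {2, 3, 4}" if "y \<in> D" for y
    using d_Int[OF that] d_ge[of y] by (simp, linarith)
  then have by_value: "(\<Sum>y\<in>D. g (d y)) = k 2 * g 2 + k 3 * g 3 + k 4 * g 4" for g
    using sum_by_value[of D "{2, 3, 4}" d g] by (simp add: k_def)
  have "d y = 4 \<longleftrightarrow> symbols y \<inter> symbols x = {}" if "y \<in> D" for y
  proof -
    have "d y = 4 \<longleftrightarrow> card (symbols x \<inter> symbols y) = 0"
      using d_Int[OF that] by linarith
    then show ?thesis by (simp add: Int_commute)
  qed
  then have "{y \<in> D. d y = 4} = {y \<in> D. symbols y \<inter> symbols x = {}}"
    by (intro Collect_cong) blast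
  then have k4: "k 4 = (real n - 2) * (real n - 3)"
    using card_avoiding[OF symbols_subset[OF x]]
    by (simp add: k_def card_symbols[OF x] del: One_nat_def)
  have d_eq_2: "d y = 2 \<longleftrightarrow> symbols y = symbols x" if "y \<in> D" for y
  proof
    assume "d y = 2"
    then have "symbols x = symbols x \<union> symbols y" "symbols y = symbols x \<union> symbols y"
      using card_symbols[OF x] card_symbols[OF that]
      by (intro card_subset_eq; simp add: d_def)+
    then show "symbols y = symbols x" by simp
  qed (simp add: d_def card_symbols[OF x])
  \<comment> \<open>Only \<open>x\<close> and its reversal use the same two symbols, whence
    \<open>k 2 = 2\<close>.\<close>
  have "symbols y = symbols x \<longleftrightarrow> y = x \<or> y = (snd x, fst x)" for y
    by (cases x; cases y) (simp add: symbols_def doubleton_eq_iff)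
  moreover have "(snd x, fst x) \<in> D"
    using x unfolding arrangements_def by (simp add: case_prod_unfold del: atLeastAtMost_iff)
  ultimately have "{y \<in> D. d y = 2} = {x, (snd x, fst x)}"
    using x d_eq_2 by blast
  moreover have "fst x \<noteq> snd x" using x by (auto simp: arrangements_def)
  ultimately have k2: "k 2 = 2" by (simp add: k_def prod_eq_iff)
  have "real (card D) = real n * (real n - 1)"
    by (simp add: card_arrangements)
  then have k3: "k 3 = 4 * (real n - 2)"
    using by_value[of "\<lambda>_. 1"] k2 k4 by (simp add: algebra_simps)
  \<comment> \<open>Omitting \<open>y = x\<close>, where \<open>d x = 2\<close>, lowers the
    coefficient of \<open>h 2\<close> from 2 to 1.\<close>
  have "(\<Sum>y\<in>D - {x}. h (d y)) = (\<Sum>y\<in>D. h (d y)) - h 2"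
    using x by (simp add: sum_diff1 d_def card_symbols)
  then show ?thesis
    using by_value[of h] by (simp add: k2 k3 k4 flip: d_def)
qed

section \<open>Assembling the counts into the formula\<close>

lemma P4_2_0_2_pair_sum:
  assumes "0 \<le> p" "p \<le> 1"
  defines "q \<equiv> \<lambda>m. p ^ (4 * fact (n - 2) - m * fact (n - 4))"
  shows "P4 n p 2 0 2 = real n * (real n - 1) / 4 *
    (pair_sum (real n) q 2 + 4 * (real n - 2) * pair_sum (real n) q 3
      + (real n - 2) * (real n - 3) * pair_sum (real n) q 4)"
proof -
  \<comment> \<open>The divisor 4 comes from ordering both two-element sets.\<close>
  have "P4 n p 2 0 2 = (\<Sum>x\<in>D. \<Sum>y\<in>D - {x}. \<Sum>z\<in>D. \<Sum>w\<in>D - {z}.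
      p ^ card (\<Union>(pre ` {x, y}) \<union> \<Union>(suf ` {z, w}))) / 4"
    by (simp add: P4_2_0_2_eq[OF assms(1,2)] sum_pairs_of flip: sum_divide_distrib)
  also have "\<dots> = (\<Sum>x\<in>D. \<Sum>y\<in>D - {x}. \<Sum>z\<in>D. \<Sum>w\<in>D - {z}.
      q (disj_ind x z + disj_ind y z + (disj_ind x w + disj_ind y w))) / 4"
  proof (intro arg_cong2[where f = "(/)"] sum.cong refl)
    fix x y z w assume A: "x \<in> D" "y \<in> D - {x}" "z \<in> D" "w \<in> D - {z}"
    have "\<Union>(pre ` {x, y}) \<union> \<Union>(suf ` {z, w}) = pre x \<union> pre y \<union> (suf z \<union> suf w)" by auto
    moreover have "x \<noteq> y" "z \<noteq> w" using A by auto
    ultimately show "p ^ card (\<Union>(pre ` {x, y}) \<union> \<Union>(suf ` {z, w})) =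
        q (disj_ind x z + disj_ind y z + (disj_ind x w + disj_ind y w))"
      using card_union4[of x y z w] A by (simp add: q_def)
  qed
  also have "\<dots> = (\<Sum>x\<in>D. \<Sum>y\<in>D - {x}. pair_sum (real n) q (card (symbols x \<union> symbols y))) / 4"
    by (simp add: sum_disj_ind[where q = q] del: One_nat_def)
  also have "\<dots> = real n * (real n - 1) / 4 *
    (pair_sum (real n) q 2 + 4 * (real n - 2) * pair_sum (real n) q 3
      + (real n - 2) * (real n - 3) * pair_sum (real n) q 4)"
    by (simp add: sum_symbol_unions[where h = "\<lambda>t. pair_sum (real n) q (real t)"]
        card_arrangements del: One_nat_def)
  finally show ?thesis .
qed

end

theorem theorem8:
  fixes n :: nat and p :: real
  assumes "n \<ge> 4" and "0 \<le> p" and "p \<le> 1"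
  shows "P4 n p 2 0 2 =
      1 / 2 * (8 * real n ^ 5 + 8 * real n ^ 4 - 174 * real n ^ 3 + 347 * real n ^ 2
        - 189 * real n) * p ^ (4 * fact (n - 2))
    + 16 * (3 * real n ^ 5 - 25 * real n ^ 4 + 75 * real n ^ 3 - 95 * real n ^ 2
        + 42 * real n) * p ^ (4 * fact (n - 2) - fact (n - 4))
    + 4 * (6 * real n ^ 6 - 73 * real n ^ 5 + 345 * real n ^ 4 - 785 * real n ^ 3
        + 849 * real n ^ 2 - 342 * real n) * p ^ (4 * fact (n - 2) - 2 * fact (n - 4))
    + 2 * (2 * real n ^ 7 - 33 * real n ^ 6 + 223 * real n ^ 5 - 785 * real n ^ 4
        + 1503 * real n ^ 3 - 1462 * real n ^ 2 + 552 * real n)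
        * p ^ (4 * fact (n - 2) - 3 * fact (n - 4))
    + 1 / 4 * (real n ^ 8 - 20 * real n ^ 7 + 172 * real n ^ 6 - 822 * real n ^ 5
        + 2340 * real n ^ 4 - 3916 * real n ^ 3 + 3499 * real n ^ 2 - 1254 * real n)
        * p ^ (4 * fact (n - 2) - 4 * fact (n - 4))"
proof -
  let ?q = "\<lambda>m. p ^ (4 * fact (n - 2) - m * fact (n - 4))"
  \<comment> \<open>Dividing by 4 with the polynomials kept as opaque \<open>a\<close> to
    \<open>e\<close> leaves them in the stated form.\<close>
  have quarter: "P = 1 / 2 * a * q0 + 16 * b * q1 + 4 * c * q2 + 2 * d * q3 + 1 / 4 * e * q4"
    if "4 * P = 2 * a * q0 + 64 * b * q1 + 16 * c * q2 + 8 * d * q3 + e * q4"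
    for P a b c d e q0 q1 q2 q3 q4 :: real
    using that by (simp add: field_simps)
  have "4 * P4 n p 2 0 2 = real n * (real n - 1) *
      (pair_sum (real n) ?q 2 + 4 * (real n - 2) * pair_sum (real n) ?q 3
        + (real n - 2) * (real n - 3) * pair_sum (real n) ?q 4)"
    by (simp add: P4_2_0_2_pair_sum[OF assms])
  from quarter[OF this[unfolded weighted_pair_sums]] show ?thesis by simp
qed

end
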